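(* Let $p,q$ be integers with $1\le p$ and $p<q-p$ (coprimality not required), and let $u=0^{q-p}1^p$. For a binary word $w\in\{0,1\}^q$ with exactly $p$ ones, put $P(w)=\prod_{i=1}^q\mathcal{I}_i(w)$. Then $P$ is minimized precisely on the orbit of $u$: for every such $w$ that is not a cyclic shift of $u$, $P(u)<P(w)$.
   Context: Binary alphabet $\{0,1\}$ with $0<1$; words of equal length are compared lexicographically. For a word $x=x_1\cdots x_n$, $(x)_2=\sum_{i=1}^n x_i2^{n-i}$. The cyclic shift is $\sigma(w_1\cdots w_n)=w_2\cdots w_nw_1$. For $w\in\{0,1\}^q$, $\mathcal{O}_1(w)\le\dots\le\mathcal{O}_q(w)$ are the $q$ words $w,\sigma(w),\dots,\sigma^{q-1}(w)$ sorted lexicographically (with repetition), and $\mathcal{I}_k(w)=(\mathcal{O}_k(w))_2$. *)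

theory Defs
  imports Main "HOL-Library.List_Lexorder"
begin

definition binword :: "nat \<Rightarrow> nat list \<Rightarrow> bool" where
  "binword q w \<longleftrightarrow> length w = q \<and> set w \<subseteq> {0, 1}"

definition val2 :: "nat list \<Rightarrow> nat" where
  "val2 x = (\<Sum>i<length x. x ! i * 2 ^ (length x - 1 - i))"

text \<open>Sorted list of the q rotations w, sigma w, ..., sigma^(q-1) w (with repetition),
  sorted lexicographically (List_Lexorder gives lexicographic order on lists).\<close>
definition orbit_sorted :: "nat list \<Rightarrow> nat list list" where
  "orbit_sorted w = sort (map (\<lambda>k. rotate k w) [0..<length w])"

definition Ow :: "nat list \<Rightarrow> nat \<Rightarrow> nat list" where
  "Ow w k = orbit_sorted w ! (k - 1)"

definition Iw :: "nat list \<Rightarrow> nat \<Rightarrow> nat" where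
  "Iw w k = val2 (Ow w k)"

definition Pw :: "nat list \<Rightarrow> nat" where
  "Pw w = (\<Prod>i=1..length w. Iw w i)"

definition count_ones :: "nat list \<Rightarrow> nat" where
  "count_ones w = length (filter (\<lambda>x. x = 1) w)"

end

theory Submission
  imports Defs Complex_Main "HOL-Library.Multiset"
begin

text \<open>
  \<open>P(w)\<close> is the product of the values of all \<open>q\<close> rotations of \<open>w\<close>, and the sum of these values
  depends only on \<open>p\<close> and \<open>q\<close>. By concavity of the logarithm it suffices that each prefix sum of
  the sorted values of \<open>w\<close> is at least the corresponding prefix sum for \<open>u\<close>. Put \<open>m = q - p\<close>. If
  \<open>w\<close> is not a rotation of \<open>u\<close>, it has at least two cyclic runs of zeros and of ones. Counting
  the rotations that begin with \<open>l \<ge> 2\<close> equal letters then shows that the \<open>m - 1\<close> smallest values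
  of \<open>w\<close> exceed those of \<open>u\<close>, and the \<open>p - 1\<close> largest do not exceed those of \<open>u\<close>. The
  \<open>(m + 1)\<close>-st value of \<open>u\<close> is the least possible among words that begin with 1. The remaining
  prefix sum, of length \<open>m\<close>, is the sum over the rotations that begin with 0; it is bounded below
  by \<open>(2^m - 1) (2^p - 1)\<close> by induction on the word.
\<close>

subsection \<open>Products and prefix sums\<close>

text \<open>Summation by parts: the prefix sum up to \<open>n\<close> is nonnegative, so its weight
  may drop from \<open>c n\<close> to \<open>c (Suc n)\<close>, the weight of the next term.\<close>

lemma abel_sum_ge:
  fixes c d :: "nat \<Rightarrow> real"
  assumes "\<And>i j. i \<le> j \<Longrightarrow> j \<le> n \<Longrightarrow> c j \<le> c i"
    and "\<And>k. k \<le> Suc n \<Longrightarrow> 0 \<le> (\<Sum>j<k. d j)"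
  shows "c n * (\<Sum>j<Suc n. d j) \<le> (\<Sum>j<Suc n. c j * d j)"
  using assms
proof (induction n)
  case 0
  show ?case by simp
next
  case (Suc n)
  have "c n * (\<Sum>j<Suc n. d j) \<le> (\<Sum>j<Suc n. c j * d j)"
    using Suc.prems by (intro Suc.IH) simp_all
  moreover have "c (Suc n) * (\<Sum>j<Suc n. d j) \<le> c n * (\<Sum>j<Suc n. d j)"
    using Suc.prems(1)[of n "Suc n"] Suc.prems(2)[of "Suc n"] by (intro mult_right_mono) simp_all
  ultimately show ?case
    by (simp add: algebra_simps)
qed

text \<open>The tangent bound \<open>ln W - ln U >= (W - U) / W\<close> has weights
  \<open>1 / W j\<close> that do not increase, because \<open>W\<close> is sorted; the Abel bound
  then makes the weighted sum nonnegative.\<close>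

lemma prod_less_of_prefix_sums_le:
  fixes U W :: "nat \<Rightarrow> real"
  assumes posU: "\<And>j. j < n \<Longrightarrow> 0 < U j" and posW: "\<And>j. j < n \<Longrightarrow> 0 < W j"
    and mono: "\<And>i j. i \<le> j \<Longrightarrow> j < n \<Longrightarrow> W i \<le> W j"
    and prefix: "\<And>k. k \<le> n \<Longrightarrow> (\<Sum>j<k. U j) \<le> (\<Sum>j<k. W j)"
    and neq: "i < n" "U i \<noteq> W i"
  shows "(\<Prod>j<n. U j) < (\<Prod>j<n. W j)"
proof -
  obtain n' where n': "n = Suc n'" using neq by (cases n) auto
  have "0 \<le> 1 / W n' * (\<Sum>j<Suc n'. W j - U j)"
    using posW[of n'] prefix[of n] by (simp add: sum_subtractf n')
  also have "\<dots> \<le> (\<Sum>j<Suc n'. 1 / W j * (W j - U j))"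
    by (rule abel_sum_ge)
      (use posW mono prefix in \<open>auto simp: n' sum_subtractf intro!: divide_left_mono\<close>)
  finally have "0 \<le> (\<Sum>j<n. 1 / W j * (W j - U j))" by (simp only: n')
  also have "\<dots> < (\<Sum>j<n. ln (W j) - ln (U j))"
  proof (rule sum_strict_mono_ex1)
    \<comment> \<open>With \<open>x = U j / W j\<close> the termwise claim is
      \<open>ln x <= x - 1\<close>, with equality only at \<open>x = 1\<close>; hence strictness at
      \<open>i\<close>.\<close>
    have eq: "1 / W j * (W j - U j) = 1 - U j / W j" if "j < n" for j
      using posW[OF that] by (simp add: field_simps)
    have ln: "ln (W j) - ln (U j) = - ln (U j / W j)" if "j < n" for j
      using posW[OF that] posU[OF that] by (simp add: ln_div)
    have pos: "0 < U j / W j" if "j < n" for j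
      using posU[OF that] posW[OF that] by simp
    show "\<forall>j\<in>{..<n}. 1 / W j * (W j - U j) \<le> ln (W j) - ln (U j)"
    proof
      fix j assume "j \<in> {..<n}"
      then have j: "j < n" by simp
      show "1 / W j * (W j - U j) \<le> ln (W j) - ln (U j)"
        unfolding eq[OF j] ln[OF j] using ln_le_minus_one[OF pos[OF j]] by linarith
    qed
    have "U i / W i \<noteq> 1"
      using posW[OF neq(1)] neq(2) by simp
    then have "ln (U i / W i) \<noteq> U i / W i - 1"
      using ln_eq_minus_one[OF pos[OF neq(1)]] by blast
    then have "1 / W i * (W i - U i) < ln (W i) - ln (U i)"
      unfolding eq[OF neq(1)] ln[OF neq(1)] using ln_le_minus_one[OF pos[OF neq(1)]] by linarith
    then show "\<exists>j\<in>{..<n}. 1 / W j * (W j - U j) < ln (W j) - ln (U j)"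
      using neq(1) by blast
  qed simp
  also have "\<dots> = ln (\<Prod>j<n. W j) - ln (\<Prod>j<n. U j)"
  proof -
    have "ln (\<Prod>j<n. f j) = (\<Sum>j<n. ln (f j))" if "\<And>j. j < n \<Longrightarrow> 0 < f j" for f :: "nat \<Rightarrow> real"
      using that by (intro ln_prod) (auto simp: less_imp_neq[symmetric])
    from this[OF posU] this[OF posW] show ?thesis by (simp add: sum_subtractf)
  qed
  finally have "ln (\<Prod>j<n. U j) < ln (\<Prod>j<n. W j)" by simp
  moreover have "0 < (\<Prod>j<n. U j)"
    by (rule prod_pos) (simp add: posU)
  moreover have "0 < (\<Prod>j<n. W j)"
    by (rule prod_pos) (simp add: posW)
  ultimately show ?thesis by simp
qed

subsection \<open>Periodic predicates\<close>

text \<open>Cyclic words are modelled as periodic predicates on the naturals, so a run may cross the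
  end of the word without a case split.\<close>

definition run :: "(nat \<Rightarrow> bool) \<Rightarrow> nat \<Rightarrow> nat \<Rightarrow> bool" where
  "run P l k \<longleftrightarrow> (\<forall>i<l. P (k + i))"

lemma sum_periodic_shift:
  fixes g :: "nat \<Rightarrow> 'a::ab_group_add"
  assumes "\<And>k. g (k + n) = g k"
  shows "(\<Sum>k<n. g (k + j)) = (\<Sum>k<n. g k)"
proof (induction j)
  case (Suc j)
  have "g j + (\<Sum>k<n. g (Suc k + j)) = (\<Sum>k<Suc n. g (k + j))"
    by (simp only: sum.lessThan_Suc_shift add_0)
  also have "\<dots> = (\<Sum>k<n. g (k + j)) + g j"
    using assms[of j] by (simp add: add.commute)
  finally show ?case using Suc by simp
qed simp

text \<open>Otherwise \<open>P\<close> would persist from \<open>a\<close> on, yet it fails at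
  translates of \<open>b\<close> beyond \<open>a\<close>; the boundary found is then reduced modulo
  \<open>n\<close>.\<close>

lemma periodic_boundary:
  fixes P :: "nat \<Rightarrow> bool"
  assumes per: "\<And>k. P (k + n) = P k" and "0 < n" and "P a" and "\<not> P b"
  shows "\<exists>k<n. P k \<and> \<not> P (Suc k)"
proof -
  have mult: "P (k + j * n) = P k" for k j
    by (induction j) (use per[of "k + _ * n"] in \<open>simp_all add: ac_simps\<close>)
  have "b + a * n \<ge> a" using \<open>0 < n\<close> by (simp add: trans_le_add2)
  then obtain d where d: "b + a * n = a + d" using le_Suc_ex by blast
  have "\<exists>k. P k \<and> \<not> P (Suc k)"
  proof (rule ccontr)
    assume "\<not> ?thesis"
    then have "P (a + d)" by (induction d) (use \<open>P a\<close> in auto)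
    then show False using mult[of b a] \<open>\<not> P b\<close> d by simp
  qed
  then obtain k where k: "P k" "\<not> P (Suc k)" by blast
  have "P (k mod n)" "\<not> P (Suc (k mod n))"
    using k mult[of "k mod n" "k div n"] mult[of "Suc (k mod n)" "k div n"] by simp_all
  then show ?thesis using \<open>0 < n\<close> mod_less_divisor by blast
qed

text \<open>Each increase of \<open>l\<close> loses at least one starting point, since the starting
  points again form a periodic set with a boundary. The step from 1 to 2 loses at least two, one per
  boundary of \<open>P\<close>.\<close>

lemma card_run_le:
  fixes P :: "nat \<Rightarrow> bool"
  assumes per: "\<And>k. P (k + n) = P k" and "0 < n" and "\<not> P b"
    and boundaries: "2 \<le> card {k. k < n \<and> P k \<and> \<not> P (Suc k)}" and "2 \<le> l"
  shows "card {k. k < n \<and> run P l k} \<le> card {k. k < n \<and> P k} - l"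
  using \<open>2 \<le> l\<close>
proof (induction l rule: dec_induct)
  case base
  have "{k. k < n \<and> run P 2 k} = {k. k < n \<and> P k} - {k. k < n \<and> P k \<and> \<not> P (Suc k)}"
    by (auto simp: run_def numeral_2_eq_2 All_less_Suc)
  also have "card \<dots> = card {k. k < n \<and> P k} - card {k. k < n \<and> P k \<and> \<not> P (Suc k)}"
    by (intro card_Diff_subset) auto
  finally show ?case using boundaries by linarith
next
  case (step l)
  have sub: "{k. k < n \<and> run P (Suc l) k} \<subseteq> {k. k < n \<and> run P l k}"
    by (auto simp: run_def)
  show ?case
  proof (cases "\<exists>k<n. run P l k")
    case True
    then obtain a where "run P l a" by blast
    moreover have "\<not> run P l b"
      using \<open>\<not> P b\<close> step unfolding run_def by (metis add_0_right not_numeral_le_zero not_gr_zero)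
    moreover have "run P l (k + n) = run P l k" for k
    proof -
      have "P (k + n + i) = P (k + i)" for i
        using per[of "k + i"] by (simp add: ac_simps)
      then show ?thesis by (simp add: run_def)
    qed
    ultimately obtain k where k: "k < n" "run P l k" "\<not> run P l (Suc k)"
      using periodic_boundary[of "run P l" n a b] \<open>0 < n\<close> by auto
    \<comment> \<open>A run of length \<open>Suc l\<close> at \<open>k\<close> would contain one of
      length \<open>l\<close> at \<open>Suc k\<close>.\<close>
    then have "\<not> run P (Suc l) k" by (auto simp: run_def All_less_Suc2)
    with k sub have "{k. k < n \<and> run P (Suc l) k} \<subset> {k. k < n \<and> run P l k}" by blast
    then have "card {k. k < n \<and> run P (Suc l) k} < card {k. k < n \<and> run P l k}"
      by (intro psubset_card_mono) auto
    then show ?thesis using step by linarith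
  next
    case False
    then have "{k. k < n \<and> run P (Suc l) k} = {}" using sub by blast
    then show ?thesis by (simp only: card.empty)
  qed
qed

text \<open>The indicators of falls and rises differ by \<open>P k - P (k + 1)\<close>, which sums
  to zero over a period.\<close>

lemma card_boundaries_swap:
  fixes P :: "nat \<Rightarrow> bool"
  assumes per: "\<And>k. P (k + n) = P k"
  shows "card {k. k < n \<and> P k \<and> \<not> P (Suc k)} = card {k. k < n \<and> \<not> P k \<and> P (Suc k)}"
proof -
  let ?g = "\<lambda>k. of_bool (P k) :: int"
  have *: "int (card {k. k < n \<and> Q k}) = (\<Sum>k<n. of_bool (Q k))" for Q
    by (simp add: Collect_conj_eq lessThan_def flip: of_nat_sum)
  have "(\<Sum>k<n. of_bool (P k \<and> \<not> P (Suc k))) - (\<Sum>k<n. of_bool (\<not> P k \<and> P (Suc k)))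
      = (\<Sum>k<n. ?g k - ?g (k + 1))"
    by (subst sum_subtractf[symmetric]) (auto intro!: sum.cong)
  also have "\<dots> = 0"
    by (subst sum_subtractf, subst sum_periodic_shift[where j = 1]) (use per in auto)
  finally show ?thesis by (simp flip: *)
qed

subsection \<open>Binary values\<close>

lemma val2_Nil [simp]: "val2 [] = 0"
  by (simp add: val2_def)

lemma val2_Cons [simp]: "val2 (a # x) = a * 2 ^ length x + val2 x"
  by (simp add: val2_def sum.lessThan_Suc_shift del: sum.lessThan_Suc)

lemma val2_append: "val2 (x @ y) = val2 x * 2 ^ length y + val2 y"
  by (induction x) (simp_all add: algebra_simps power_add)

lemma val2_replicate_0 [simp]: "val2 (replicate n 0) = 0"
  by (induction n) simp_all

lemma val2_replicate_1 [simp]: "val2 (replicate n (Suc 0)) = 2 ^ n - 1"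
  by (induction n) simp_all

lemma count_ones_simps [simp]:
  "count_ones [] = 0" "count_ones (a # x) = (if a = 1 then 1 else 0) + count_ones x"
  "count_ones (x @ y) = count_ones x + count_ones y"
  by (simp_all add: count_ones_def)

lemma count_ones_le_length: "count_ones x \<le> length x"
  by (simp add: count_ones_def)

text \<open>For a given number of ones the value is least when they all stand at the right end; the
  additive form avoids truncated subtraction.\<close>

lemma val2_ge: "2 ^ count_ones x \<le> Suc (val2 x)"
proof (induction x)
  case (Cons a x)
  have le: "(2::nat) ^ count_ones x \<le> 2 ^ length x"
    by (simp add: count_ones_le_length)
  show ?case
  proof (cases "a = 1")
    case True
    then have "2 ^ count_ones (a # x) = 2 ^ count_ones x + (2::nat) ^ count_ones x"
      "val2 (a # x) = 2 ^ length x + val2 x" by simp_all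
    then show ?thesis using Cons le by linarith
  next
    case False
    then show ?thesis using Cons by simp
  qed
qed simp

lemma rotate_add_length [simp]: "rotate (k + length w) w = rotate k w"
  by (subst (1 2) rotate_conv_mod) simp

section \<open>Lower bound for the rotations that begin with 0\<close>

text \<open>Sums the rotations that begin with 0, with the letters that wrap around replaced by
  zeros. Prepending a letter adds one such padding zero to every later suffix, hence the
  doubling.\<close>

fun zero_sum :: "nat list \<Rightarrow> nat" where
  "zero_sum [] = 0"
| "zero_sum (a # x) = (if a = 0 then val2 x else 0) + 2 * zero_sum x"

lemma zero_sum_replicate_1_append:
  "zero_sum (replicate s (Suc 0) @ x) = 2 ^ s * zero_sum x"
  by (induction s) simp_all

text \<open>Absorbing a block of ones leaves the inductive bound with the surplus
  \<open>(2^s - 1) (2^(m + 1) - 1) (2^p - 2)\<close>, where the rest of the word has \<open>m\<close> zeros and \<open>p\<close> ones;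
  it is nonnegative because \<open>p \<ge> 1\<close>, as the word ends with 1.\<close>
lemma zero_sum_ge_aux:
  assumes "set y \<subseteq> {0, 1}" and "y = [] \<or> last y = 1"
  shows "(2 ^ Suc (length y - count_ones y) - 1) * (2 ^ (s + count_ones y) - 1)
    \<le> int (zero_sum (0 # replicate s 1 @ y))"
  using assms
proof (induction y arbitrary: s)
  case Nil
  then show ?case using zero_sum_replicate_1_append[of s "[]"] by (simp add: of_nat_diff)
next
  case (Cons a y)
  show ?case
  proof (cases "a = 1")
    case True
    \<comment> \<open>A further 1 joins the leading block, so the induction hypothesis is used with
      \<open>Suc s\<close>.\<close>
    have eq: "replicate s 1 @ a # y = replicate (Suc s) 1 @ y"
      using True by (simp add: replicate_app_Cons_same)
    have len: "length (a # y) - count_ones (a # y) = length y - count_ones y"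
      "s + count_ones (a # y) = Suc s + count_ones y"
      using True by simp_all
    show ?thesis
      unfolding eq len by (rule Cons.IH) (use Cons.prems in \<open>auto split: if_splits\<close>)
  next
    case False
    then have a: "a = 0" and y: "y \<noteq> []" "last y = 1" using Cons.prems by (auto split: if_splits)
    define m where "m = length y - count_ones y"
    define p where "p = count_ones y"
    have len: "length y = m + p" using count_ones_le_length[of y] by (simp add: m_def p_def)
    have "1 \<in> set y" using y by (metis last_in_set)
    then have "p \<noteq> 0" by (auto simp: p_def count_ones_def filter_empty_conv)
    then have R: "(2::int) \<le> 2 ^ p" by (cases p) simp_all
    let ?S = "2 ^ s :: int" and ?M = "2 ^ m :: int" and ?R = "2 ^ p :: int"
    \<comment> \<open>The new 0 starts a fresh, empty block of ones.\<close>
    have IH: "(2 * ?M - 1) * (?R - 1) \<le> int (zero_sum (0 # y))"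
      using Cons.IH[of 0] Cons.prems y by (simp add: m_def p_def)
    have val: "?R - 1 \<le> int (val2 y)"
      using val2_ge[of y] unfolding p_def by (simp flip: of_nat_le_iff[where 'a = int])
    \<comment> \<open>The leading 0 contributes the value of \<open>1^s 0 y\<close>; the zeros after
      it count with the factor \<open>2 * 2^s\<close>, one doubling for each letter in
      front.\<close>
    have eq: "int (zero_sum (0 # replicate s 1 @ a # y))
        = (?S - 1) * (2 * ?M * ?R) + int (val2 y) + 2 * ?S * int (zero_sum (0 # y))"
    proof -
      have "int (val2 (replicate s 1 @ 0 # y)) = (?S - 1) * (2 * ?M * ?R) + int (val2 y)"
        by (simp add: val2_append len power_add of_nat_diff)
      moreover have "int (zero_sum (replicate s 1 @ 0 # y)) = ?S * int (zero_sum (0 # y))"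
        using zero_sum_replicate_1_append[of s "0 # y"] by (simp del: zero_sum.simps(2))
      ultimately show ?thesis
        unfolding a zero_sum.simps(2)[of 0 "replicate s 1 @ 0 # y"]
        by (simp del: zero_sum.simps)
    qed
    have "0 \<le> (?S - 1) * (2 * ?M - 1) * (?R - 2)"
      using R by (intro mult_nonneg_nonneg) auto
    moreover have "2 * ?S * ((2 * ?M - 1) * (?R - 1)) \<le> 2 * ?S * int (zero_sum (0 # y))"
      using IH by (intro mult_left_mono) auto
    ultimately have "(4 * ?M - 1) * (?S * ?R - 1) \<le> int (zero_sum (0 # replicate s 1 @ a # y))"
      unfolding eq using val by (simp add: algebra_simps)
    moreover have "Suc (length (a # y) - count_ones (a # y)) = m + 2"
      using len a by (simp add: p_def)
    ultimately show ?thesis using a by (simp add: p_def power_add)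
  qed
qed

text \<open>The case of an empty block of ones after the leading 0; \<open>0^m 1^p\<close> attains
  equality.\<close>

lemma zero_sum_ge:
  assumes "set x \<subseteq> {0, 1}" and "hd x = 0" and "last x = 1" and "x \<noteq> []"
  shows "(2 ^ (length x - count_ones x) - 1) * (2 ^ count_ones x - 1) \<le> int (zero_sum x)"
proof -
  obtain y where x: "x = 0 # y" using assms by (cases x) auto
  show ?thesis
    using zero_sum_ge_aux[of y 0] assms count_ones_le_length[of y]
    by (simp add: x Suc_diff_le split: if_splits)
qed

lemma zero_sum_eq: "zero_sum x = (\<Sum>k<length x. if x ! k = 0 then val2 (drop k x) * 2 ^ k else 0)"
proof (induction x)
  case (Cons a x)
  have "(\<Sum>k<length (a # x). if (a # x) ! k = 0 then val2 (drop k (a # x)) * 2 ^ k else 0)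
      = (if a = 0 then val2 x else 0)
        + (\<Sum>k<length x. 2 * (if x ! k = 0 then val2 (drop k x) * 2 ^ k else 0))"
    unfolding list.size(4) add_0_right add_Suc_right sum.lessThan_Suc_shift
    by (intro arg_cong2[of _ _ _ _ "(+)"] sum.cong) auto
  then show ?case
    using Cons by (simp flip: sum_distrib_left)
qed simp

text \<open>Restoring the letters that wrap around, in place of the padding zeros, can only increase
  each value.\<close>

lemma zero_sum_le:
  "zero_sum x \<le> (\<Sum>k<length x. if x ! k = 0 then val2 (rotate k x) else 0)"
  unfolding zero_sum_eq
  by (intro sum_mono) (auto simp: rotate_drop_take val2_append)

subsection \<open>Sorted enumerations\<close>

lemma sum_nth_sort:
  fixes x :: "nat \<Rightarrow> 'a::linorder"
  shows "(\<Sum>j<n. g (sort (map x [0..<n]) ! j)) = (\<Sum>k<n. g (x k))"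
proof -
  let ?V = "sort (map x [0..<n])"
  have "(\<Sum>j<n. g (?V ! j)) = sum_list (map g ?V)"
    by (simp add: sum_list_sum_nth atLeast0LessThan)
  also have "\<dots> = sum_mset (image_mset g (mset (map x [0..<n])))"
    by (simp flip: sum_mset_sum_list)
  also have "\<dots> = sum_list (map g (map x [0..<n]))"
    by (simp only: mset_map[symmetric] sum_mset_sum_list)
  also have "\<dots> = (\<Sum>k<n. g (x k))"
    by (simp add: sum_list_sum_nth atLeast0LessThan)
  finally show ?thesis .
qed

lemma prod_nth_sort:
  fixes x :: "nat \<Rightarrow> 'a::linorder"
  shows "(\<Prod>j<n. g (sort (map x [0..<n]) ! j)) = (\<Prod>k<n. g (x k))"
proof -
  let ?V = "sort (map x [0..<n])"
  have "(\<Prod>j<n. g (?V ! j)) = prod_list (map g ?V)"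
    by (simp add: prod.list_conv_set_nth atLeast0LessThan)
  also have "\<dots> = prod_mset (image_mset g (mset (map x [0..<n])))"
    by (simp flip: prod_mset_prod_list)
  also have "\<dots> = prod_list (map g (map x [0..<n]))"
    by (simp only: mset_map[symmetric] prod_mset_prod_list)
  also have "\<dots> = (\<Prod>k<n. g (x k))"
    by (simp add: prod.list_conv_set_nth atLeast0LessThan)
  finally show ?thesis .
qed

text \<open>A product ignores order, so the lexicographic sorting drops out and only the multiset of
  rotations matters.\<close>

lemma Pw_eq: "Pw w = (\<Prod>k<length w. val2 (rotate k w))"
proof -
  have "Pw w = (\<Prod>j<length w. val2 (orbit_sorted w ! j))"
    unfolding Pw_def Iw_def Ow_def
    by (rule prod.reindex_bij_witness[of _ Suc "\<lambda>i. i - 1"]) auto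
  then show ?thesis
    unfolding orbit_sorted_def by (simp only: prod_nth_sort)
qed

lemma card_filter_sort:
  "card {j. j < n \<and> Q (sort (map x [0..<n]) ! j)} = card {k. k < n \<and> Q (x k)}"
  using sum_nth_sort[where g = "\<lambda>y. of_bool (Q y) :: nat" and x = x and n = n]
  by (simp add: Collect_conj_eq lessThan_def)

text \<open>If the entry at \<open>j\<close> were below \<open>B\<close>, so would be all
  \<open>j + 1\<close> entries up to it.\<close>

lemma sort_nth_ge:
  fixes x :: "nat \<Rightarrow> 'a::linorder"
  assumes "card {k. k < n \<and> x k < B} \<le> j" and "j < n"
  shows "B \<le> sort (map x [0..<n]) ! j"
proof (rule ccontr)
  let ?V = "sort (map x [0..<n])"
  assume "\<not> ?thesis"
  then have "?V ! i < B" if "i \<le> j" for i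
    using sorted_nth_mono[of ?V i j] that \<open>j < n\<close> by simp
  then have "{..j} \<subseteq> {j. j < n \<and> ?V ! j < B}"
    using \<open>j < n\<close> by auto
  then have "card {..j} \<le> card {j. j < n \<and> ?V ! j < B}"
    by (rule card_mono[rotated]) simp
  then show False
    using assms(1) by (simp add: card_filter_sort[where Q = "\<lambda>y. y < B"])
qed

text \<open>Dually, the \<open>n - j\<close> entries from \<open>j\<close> on would all be at least
  \<open>B\<close>.\<close>

lemma sort_nth_less:
  fixes x :: "nat \<Rightarrow> 'a::linorder"
  assumes "card {k. k < n \<and> B \<le> x k} < n - j"
  shows "sort (map x [0..<n]) ! j < B"
proof (rule ccontr)
  let ?V = "sort (map x [0..<n])"
  assume "\<not> ?thesis"
  then have "B \<le> ?V ! i" if "j \<le> i" "i < n" for i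
    using sorted_nth_mono[of ?V j i] that by simp
  then have "{j..<n} \<subseteq> {j. j < n \<and> B \<le> ?V ! j}"
    by auto
  then have "card {j..<n} \<le> card {j. j < n \<and> B \<le> ?V ! j}"
    by (rule card_mono[rotated]) simp
  then show False
    using assms(1) by (simp add: card_filter_sort[where Q = "\<lambda>y. B \<le> y"])
qed

text \<open>The \<open>m\<close> entries below \<open>B\<close> occupy exactly the first
  \<open>m\<close> places after sorting.\<close>

lemma sum_sort_prefix:
  fixes x :: "nat \<Rightarrow> 'a::{linorder,comm_monoid_add}"
  assumes m: "card {k. k < n \<and> x k < B} = m"
  shows "(\<Sum>j<m. sort (map x [0..<n]) ! j) = (\<Sum>k<n. if x k < B then x k else 0)"
proof -
  let ?V = "sort (map x [0..<n])"
  have "card {k. k < n \<and> B \<le> x k} = card ({..<n} - {k. k < n \<and> x k < B})"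
    by (intro arg_cong[where f = card]) auto
  also have "\<dots> = n - m"
    by (subst card_Diff_subset) (auto simp: m)
  finally have card_ge: "card {k. k < n \<and> B \<le> x k} = n - m" .
  have "card {k. k < n \<and> x k < B} \<le> card {..<n}"
    by (intro card_mono) auto
  then have "m \<le> n" by (simp add: m)
  have "(\<Sum>k<n. if x k < B then x k else 0) = (\<Sum>j<n. if ?V ! j < B then ?V ! j else 0)"
    by (rule sum_nth_sort[symmetric])
  also have "\<dots> = (\<Sum>j<n. if j < m then ?V ! j else 0)"
  proof (intro sum.cong refl)
    fix j assume "j \<in> {..<n}"
    then have "?V ! j < B \<longleftrightarrow> j < m"
      using sort_nth_ge[of n x B j] sort_nth_less[of n B x j] m card_ge \<open>m \<le> n\<close>
      by (cases "j < m") (auto simp: not_less diff_less_mono2)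
    then show "(if ?V ! j < B then ?V ! j else 0) = (if j < m then ?V ! j else 0)"
      by simp
  qed
  also have "\<dots> = (\<Sum>j\<in>{j \<in> {..<n}. j < m}. ?V ! j)"
    by (subst sum.inter_filter) auto
  also have "{j \<in> {..<n}. j < m} = {..<m}"
    using \<open>m \<le> n\<close> by auto
  finally show ?thesis ..
qed

subsection \<open>Rotations of binary words\<close>

text \<open>A nonzero letter among the first \<open>l\<close> alone contributes at least
  \<open>2 ^ (length x - l)\<close>.\<close>

lemma val2_less_imp_nth_0:
  assumes "val2 x < 2 ^ (length x - l)" and "i < l" and "l \<le> length x"
  shows "x ! i = 0"
proof (rule ccontr)
  assume "x ! i \<noteq> 0"
  then have "(2::nat) ^ (length x - l) \<le> x ! i * 2 ^ (length x - 1 - i)"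
    using assms by (intro order_trans[OF power_increasing[of "length x - l" "length x - 1 - i"]]) auto
  also have "\<dots> \<le> val2 x"
    unfolding val2_def using assms by (intro member_le_sum) auto
  finally show False using assms by simp
qed

lemma val2_complement:
  assumes "set x \<subseteq> {0, 1}"
  shows "Suc (val2 x + val2 (map (\<lambda>a. 1 - a) x)) = 2 ^ length x"
  using assms by (induction x) auto

lemma val2_less: "set x \<subseteq> {0, 1} \<Longrightarrow> val2 x < 2 ^ length x"
  using val2_complement[of x] by simp

lemma val2_ge_imp_nth_1:
  assumes "set x \<subseteq> {0, 1}" and "2 ^ length x \<le> val2 x + 2 ^ (length x - l)"
    and "i < l" and "l \<le> length x"
  shows "x ! i = 1"
proof -
  let ?y = "map (\<lambda>a. 1 - a) x"
  \<comment> \<open>The complement has value \<open>2 ^ length x - 1 - val2 x\<close>, so it begins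
    with \<open>l\<close> zeros.\<close>
  have "val2 ?y < 2 ^ (length ?y - l)"
    using val2_complement[OF assms(1)] assms(2) by simp
  then have "?y ! i = 0"
    using assms by (intro val2_less_imp_nth_0) auto
  moreover have "x ! i \<in> {0, 1}"
    using assms by (meson nth_mem order_less_le_trans subset_iff)
  ultimately show ?thesis
    using assms by auto
qed

lemma count_ones_rotate [simp]: "count_ones (rotate k w) = count_ones w"
proof (induction k)
  case (Suc k)
  have "count_ones (rotate1 x) = count_ones x" for x
    by (cases x) simp_all
  with Suc show ?case by (simp add: rotate_def)
qed simp

lemma count_ones_eq_card: "count_ones w = card {k. k < length w \<and> w ! k = 1}"
  by (simp add: count_ones_def length_filter_conv_card)

lemma ex_nth_mod_eq_1:
  assumes "1 \<le> count_ones w"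
  shows "\<exists>k. w ! (k mod length w) = 1"
proof -
  have "{k. k < length w \<and> w ! k = 1} \<noteq> {}"
    using assms unfolding count_ones_eq_card by (metis card.empty not_one_le_zero)
  then obtain k where "k < length w" "w ! k = 1" by auto
  then show ?thesis by (auto intro: exI[of _ k])
qed

lemma ex_nth_mod_neq_1:
  assumes "count_ones w < length w"
  shows "\<exists>k. w ! (k mod length w) \<noteq> 1"
proof -
  have "{k. k < length w \<and> w ! k = 1} \<noteq> {..<length w}"
    using assms unfolding count_ones_eq_card by (metis card_lessThan less_irrefl)
  then obtain k where "k < length w" "w ! k \<noteq> 1" by auto
  then show ?thesis by (auto intro: exI[of _ k])
qed

text \<open>Over all rotations each letter visits each place once, so every place value is
  multiplied by the number of ones.\<close>

lemma sum_val2_rotate: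
  assumes "set w \<subseteq> {0, 1}"
  shows "(\<Sum>k<length w. int (val2 (rotate k w))) = int (count_ones w) * (2 ^ length w - 1)"
proof -
  define q where "q = length w"
  define f where "f k = int (w ! (k mod q))" for k
  have "(\<Sum>k<q. f k) = (\<Sum>k<q. of_bool (w ! k = 1))"
  proof (intro sum.cong refl)
    fix k assume "k \<in> {..<q}"
    then have "w ! k \<in> {0, 1}" using assms by (auto simp: q_def dest: nth_mem)
    then show "f k = of_bool (w ! k = 1)" using \<open>k \<in> {..<q}\<close> by (auto simp: f_def)
  qed
  also have "\<dots> = int (count_ones w)"
    by (simp add: count_ones_eq_card q_def Collect_conj_eq lessThan_def flip: of_nat_sum)
  finally have f: "(\<Sum>k<q. f k) = int (count_ones w)" .
  have "(\<Sum>k<q. int (val2 (rotate k w))) = (\<Sum>k<q. \<Sum>i<q. f (k + i) * 2 ^ (q - 1 - i))"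
    by (simp add: val2_def nth_rotate f_def q_def add.commute)
  also have "\<dots> = (\<Sum>i<q. (\<Sum>k<q. f (k + i)) * 2 ^ (q - 1 - i))"
    by (subst sum.swap) (simp add: sum_distrib_right)
  also have "\<dots> = (\<Sum>i<q. int (count_ones w) * 2 ^ (q - 1 - i))"
    by (subst sum_periodic_shift) (simp_all add: f_def[of "_ + q"] f_def[symmetric] f)
  also have "\<dots> = int (count_ones w) * int (val2 (replicate q 1))"
    by (simp add: val2_def sum_distrib_left)
  also have "int (val2 (replicate q 1)) = 2 ^ q - 1"
    by (simp add: of_nat_diff)
  finally show ?thesis by (simp add: q_def)
qed

section \<open>Cyclic blocks of ones\<close>

lemma sorted_binary:
  assumes "set x \<subseteq> {0, 1}" and "sorted x"
  shows "x = replicate (length x - count_ones x) 0 @ replicate (count_ones x) 1"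
  using assms
proof (induction x)
  case (Cons a x)
  show ?case
  proof (cases "a = 1")
    case True
    with Cons.prems have "\<forall>b\<in>set (a # x). b = 1" by fastforce
    then have "a # x = replicate (length (a # x)) 1"
      by (metis replicate_length_same)
    moreover from this have "count_ones (a # x) = length (a # x)"
      by (metis count_ones_def filter_replicate length_replicate)
    ultimately show ?thesis by (metis append_Nil diff_self_eq_0 replicate_0)
  next
    case False
    then show ?thesis
      using Cons count_ones_le_length[of x] by (simp add: Suc_diff_le)
  qed
qed simp

text \<open>With a single cyclic fall from 1 to 0, the rotation that starts right after it is
  sorted, hence equal to \<open>0^(q-p) 1^p\<close>.\<close>

lemma card_boundaries_ge_2:
  assumes w: "binword q w" and p: "count_ones w = p" "1 \<le> p" "p < q"
    and not_rot: "\<forall>k. w \<noteq> rotate k (replicate (q - p) 0 @ replicate p 1)"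
  shows "2 \<le> card {k. k < q \<and> w ! (k mod q) = 1 \<and> w ! (Suc k mod q) \<noteq> 1}"
proof (rule ccontr)
  let ?P = "\<lambda>k. w ! (k mod q) = 1"
  let ?B = "{k. k < q \<and> ?P k \<and> \<not> ?P (Suc k)}"
  assume less: "\<not> 2 \<le> card ?B"
  have len: "length w = q" and set: "set w \<subseteq> {0, 1}"
    using w by (auto simp: binword_def)
  have card: "card {k. k < q \<and> w ! k = 1} = p"
    using p by (simp add: count_ones_eq_card len)
  obtain a where a: "?P a"
    using ex_nth_mod_eq_1[of w] p by (auto simp: len)
  obtain b where b: "\<not> ?P b"
    using ex_nth_mod_neq_1[of w] p by (auto simp: len)
  from periodic_boundary[of ?P q a b] a b p obtain k where k: "k \<in> ?B" by auto
  have "card ?B \<le> Suc 0" "finite ?B"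
    using less by simp_all
  then have uniq: "k' = k" if "k' \<in> ?B" for k'
    using k that card_le_Suc0_iff_eq by blast
  define v where "v = rotate (Suc k) w"
  have v_nth: "v ! i = w ! ((Suc k + i) mod q)" if "i < q" for i
    using that by (simp add: v_def nth_rotate len del: rotate_Suc)
  have lenv: "length v = q" and setv: "set v \<subseteq> {0, 1}"
    using set by (simp_all add: v_def len del: rotate_Suc)
  have "sorted v"
    unfolding sorted_iff_nth_Suc
  proof (intro allI impI)
    fix i assume "Suc i < length v"
    then have i: "Suc i < q" by (simp add: lenv)
    show "v ! i \<le> v ! Suc i"
    proof (rule ccontr)
      assume "\<not> ?thesis"
      moreover have "v ! i \<in> {0, 1}" "v ! Suc i \<in> {0, 1}"
        using subsetD[OF setv nth_mem] i lenv by (simp_all del: insert_iff)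
      ultimately have "v ! i = 1" "v ! Suc i \<noteq> 1" by auto
      then have "(Suc k + i) mod q \<in> ?B"
        using i v_nth[of i] v_nth[of "Suc i"] p by (simp add: mod_Suc_eq)
      \<comment> \<open>A fall inside \<open>v\<close> would have to be the one at \<open>k\<close>,
        but that is the last position of \<open>v\<close>, which \<open>Suc i < q\<close>
        excludes.\<close>
      then have "(Suc k + i) mod q = k" by (rule uniq)
      moreover have "k < q" using k by simp
      ultimately have "k + Suc i = k \<or> k + Suc i = k + q"
        using i by (cases "k + Suc i < q") (auto simp: not_less le_mod_geq)
      then show False using i by simp
    qed
  qed
  from sorted_binary[OF setv this] have "v = replicate (q - p) 0 @ replicate p 1"
    using p by (simp add: v_def len del: rotate_Suc)
  \<comment> \<open>Completes the full turn of \<open>q\<close> positions.\<close>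
  moreover have "w = rotate (q - Suc k) v"
    using k by (simp add: v_def rotate_rotate len del: rotate_Suc)
  ultimately show False using not_rot by blast
qed

section \<open>Rotations classified by their initial letters\<close>

text \<open>The rotation begins with 1 and carries \<open>count_ones w - 1\<close> further ones,
  which contribute least at the right end.\<close>

lemma val2_rotate_ge:
  assumes "set w \<subseteq> {0, 1}" and "w \<noteq> []" and "2 ^ (length w - 1) \<le> val2 (rotate k w)"
  shows "2 ^ (length w - 1) + 2 ^ (count_ones w - 1) \<le> Suc (val2 (rotate k w))"
proof -
  obtain a y where ay: "rotate k w = a # y"
    using assms(2) by (metis neq_Nil_conv rotate_is_Nil_conv)
  have len: "length w = Suc (length y)" and set: "set (a # y) \<subseteq> {0, 1}"
    using ay assms(1) by (metis length_Cons length_rotate, metis set_rotate)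
  have "a = 1"
    using assms(3) set val2_less[of y] by (auto simp: ay len)
  moreover have "count_ones w = count_ones (a # y)"
    by (metis ay count_ones_rotate)
  ultimately show ?thesis
    using val2_ge[of y] by (simp add: ay len)
qed

lemma val2_rotate_less_iff:
  assumes "set w \<subseteq> {0, 1}" and "k < length w"
  shows "val2 (rotate k w) < 2 ^ (length w - 1) \<longleftrightarrow> w ! k = 0"
proof -
  obtain a y where ay: "rotate k w = a # y"
    using assms(2) by (metis length_0_conv length_rotate neq_Nil_conv not_less_zero)
  have len: "length w = Suc (length y)" and set: "set (a # y) \<subseteq> {0, 1}"
    using ay assms(1) by (metis length_Cons length_rotate, metis set_rotate)
  have "w ! k = a"
    using nth_rotate[of 0 w k] assms(2) by (cases "w = []") (simp_all add: ay)
  then show ?thesis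
    using set val2_less[of y] by (auto simp: ay len)
qed

text \<open>The sum is the same for all rotations of \<open>w\<close>, so \<open>w\<close> may be
  cut between a 1 and a following 0; it then begins with 0 and ends with 1, as
  \<open>zero_sum_ge\<close> requires.\<close>

lemma sum_zero_rotations_ge:
  assumes set: "set w \<subseteq> {0, 1}" and p: "1 \<le> count_ones w" "count_ones w < length w"
  shows "(2 ^ (length w - count_ones w) - 1) * (2 ^ count_ones w - 1)
    \<le> (\<Sum>k<length w. if val2 (rotate k w) < 2 ^ (length w - 1) then int (val2 (rotate k w)) else 0)"
proof -
  define q where "q = length w"
  let ?P = "\<lambda>k. w ! (k mod q) = 1"
  let ?g = "\<lambda>x. if val2 x < 2 ^ (q - 1) then int (val2 x) else 0"
  have card: "card {k. k < q \<and> w ! k = 1} = count_ones w"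
    by (simp add: count_ones_eq_card q_def)
  obtain a where a: "?P a"
    using ex_nth_mod_eq_1[of w] p by (auto simp: q_def)
  obtain b where b: "\<not> ?P b"
    using ex_nth_mod_neq_1[of w] p by (auto simp: q_def)
  have "0 < q" using p unfolding q_def by linarith
  with periodic_boundary[of ?P q a b] a b obtain k where k: "k < q" "?P k" "\<not> ?P (Suc k)" by auto
  define v where "v = rotate (Suc k) w"
  have lenv: "length v = q" "v \<noteq> []" and setv: "set v \<subseteq> {0, 1}" and onesv: "count_ones v = count_ones w"
    using set \<open>0 < q\<close> unfolding v_def q_def by (simp_all del: rotate_Suc)
  have nth: "v ! i = w ! ((Suc k + i) mod q)" if "i < q" for i
    using that by (simp add: v_def nth_rotate q_def del: rotate_Suc)
  have "hd v \<noteq> 1"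
    using nth[of 0] k \<open>0 < q\<close> lenv by (simp add: hd_conv_nth)
  then have "hd v = 0"
    using setv lenv by (auto simp: neq_Nil_conv)
  moreover have "last v = 1"
    using nth[of "q - 1"] k \<open>0 < q\<close> lenv by (simp add: last_conv_nth)
  ultimately have "(2 ^ (q - count_ones w) - 1) * (2 ^ count_ones w - 1) \<le> int (zero_sum v)"
    using zero_sum_ge[OF setv] lenv onesv by simp
  also have "\<dots> \<le> int (\<Sum>k<q. if v ! k = 0 then val2 (rotate k v) else 0)"
    using zero_sum_le[of v] lenv by (simp only: of_nat_le_iff)
  also have "\<dots> = (\<Sum>j<q. ?g (rotate j v))"
    unfolding of_nat_sum
  proof (intro sum.cong refl)
    fix j assume "j \<in> {..<q}"
    then show "int (if v ! j = 0 then val2 (rotate j v) else 0) = ?g (rotate j v)"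
      using val2_rotate_less_iff[OF setv, of j] lenv(1) by simp
  qed
  also have "\<dots> = (\<Sum>j<q. ?g (rotate (j + Suc k) w))"
    by (simp only: v_def rotate_rotate)
  also have "\<dots> = (\<Sum>j<q. ?g (rotate j w))"
    by (rule sum_periodic_shift) (simp add: q_def)
  finally show ?thesis by (simp only: q_def)
qed

text \<open>The rotations counted begin with \<open>l\<close> zeros, so they mark runs of non-ones;
  \<open>card_run_le\<close> applies since \<open>w\<close> has at least two blocks.\<close>

lemma card_val2_less_le:
  assumes w: "binword q w" and p: "count_ones w = p" "1 \<le> p" "p < q"
    and not_rot: "\<forall>k. w \<noteq> rotate k (replicate (q - p) 0 @ replicate p 1)"
    and l: "2 \<le> l" "l \<le> q"
  shows "card {k. k < q \<and> val2 (rotate k w) < 2 ^ (q - l)} \<le> q - p - l"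
proof -
  let ?P = "\<lambda>k. w ! (k mod q) \<noteq> 1"
  have len: "length w = q" using w by (simp add: binword_def)
  have card: "card {k. k < q \<and> w ! k = 1} = p"
    using p by (simp add: count_ones_eq_card len)
  obtain b where b: "\<not> ?P b"
    using ex_nth_mod_eq_1[of w] p by (auto simp: len)
  have "{k. k < q \<and> val2 (rotate k w) < 2 ^ (q - l)} \<subseteq> {k. k < q \<and> run ?P l k}"
  proof clarify
    fix k assume k: "val2 (rotate k w) < 2 ^ (q - l)"
    then have "rotate k w ! i = 0" if "i < l" for i
      using val2_less_imp_nth_0[of "rotate k w" l i] that l len by simp
    then show "run ?P l k"
      using l by (simp add: run_def nth_rotate len)
  qed
  then have "card {k. k < q \<and> val2 (rotate k w) < 2 ^ (q - l)} \<le> card {k. k < q \<and> run ?P l k}"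
    by (intro card_mono) auto
  also have "\<dots> \<le> card {k. k < q \<and> ?P k} - l"
  proof (rule card_run_le)
    \<comment> \<open>Rises from 0 to 1 are as many as falls from 1 to 0.\<close>
    show "2 \<le> card {k. k < q \<and> ?P k \<and> \<not> ?P (Suc k)}"
      using card_boundaries_ge_2[OF w p not_rot] card_boundaries_swap[of "\<lambda>k. w ! (k mod q) = 1" q]
      by simp
  qed (use b l p in auto)
  also have "{k. k < q \<and> ?P k} = {..<q} - {k. k < q \<and> w ! k = 1}"
    by auto
  also have "card \<dots> = q - p"
    by (subst card_Diff_subset) (use card in auto)
  finally show ?thesis .
qed

text \<open>Here \<open>2 ^ q - 2 ^ (q - l)\<close> is the value of \<open>1^l 0^(q-l)\<close>, so
  the rotations counted begin with \<open>l\<close> ones.\<close>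

lemma card_val2_ge_le:
  assumes w: "binword q w" and p: "count_ones w = p" "1 \<le> p" "p < q"
    and not_rot: "\<forall>k. w \<noteq> rotate k (replicate (q - p) 0 @ replicate p 1)"
    and l: "2 \<le> l" "l \<le> q"
  shows "card {k. k < q \<and> 2 ^ q - 2 ^ (q - l) \<le> val2 (rotate k w)} \<le> p - l"
proof -
  let ?P = "\<lambda>k. w ! (k mod q) = 1"
  have len: "length w = q" and set: "set w \<subseteq> {0, 1}" using w by (simp_all add: binword_def)
  have card: "card {k. k < q \<and> w ! k = 1} = p"
    using p by (simp add: count_ones_eq_card len)
  obtain b where b: "\<not> ?P b"
    using ex_nth_mod_neq_1[of w] p by (auto simp: len)
  have "{k. k < q \<and> 2 ^ q - 2 ^ (q - l) \<le> val2 (rotate k w)} \<subseteq> {k. k < q \<and> run ?P l k}"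
  proof clarify
    fix k assume k: "2 ^ q - 2 ^ (q - l) \<le> val2 (rotate k w)"
    then have "rotate k w ! i = 1" if "i < l" for i
      using val2_ge_imp_nth_1[of "rotate k w" l i] that l len set by (simp add: le_diff_conv)
    then show "run ?P l k"
      using l by (simp add: run_def nth_rotate len)
  qed
  then have "card {k. k < q \<and> 2 ^ q - 2 ^ (q - l) \<le> val2 (rotate k w)} \<le> card {k. k < q \<and> run ?P l k}"
    by (intro card_mono) auto
  also have "\<dots> \<le> card {k. k < q \<and> ?P k} - l"
    by (rule card_run_le) (use b l p card_boundaries_ge_2[OF w p not_rot] in auto)
  also have "{k. k < q \<and> ?P k} = {k. k < q \<and> w ! k = 1}"
    by auto
  finally show ?thesis using card by simp
qed

section \<open>The rotations of the block word\<close>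

text \<open>The rotated word is \<open>0^(m-k) 1^p 0^k\<close>.\<close>

lemma val2_rotate_block_zeros:
  assumes "k \<le> m"
  shows "val2 (rotate k (replicate m 0 @ replicate p 1)) = (2 ^ p - 1) * 2 ^ k"
proof -
  have "replicate m (0::nat) @ replicate p 1 = replicate k 0 @ (replicate (m - k) 0 @ replicate p 1)"
    using assms by (simp flip: replicate_add append_assoc)
  then have "rotate k (replicate m (0::nat) @ replicate p 1)
      = (replicate (m - k) 0 @ replicate p 1) @ replicate k 0"
    using rotate_append[of "replicate k (0::nat)" "replicate (m - k) 0 @ replicate p 1"] by simp
  then show ?thesis by (simp add: val2_append)
qed

text \<open>The rotated word is \<open>1^(p-t) 0^m 1^t\<close>; integers avoid truncated
  subtraction.\<close>

lemma val2_rotate_block_ones: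
  assumes "t \<le> p"
  shows "int (val2 (rotate (m + t) (replicate m 0 @ replicate p 1)))
    = 2 ^ (m + p) - 2 ^ (m + t) + 2 ^ t - 1"
proof -
  have "replicate m 0 @ replicate p (1::nat) = (replicate m 0 @ replicate t 1) @ replicate (p - t) 1"
    using assms by (simp flip: replicate_add)
  then have "rotate (m + t) (replicate m 0 @ replicate p (1::nat))
      = replicate (p - t) 1 @ (replicate m 0 @ replicate t 1)"
    using rotate_append[of "replicate m 0 @ replicate t (1::nat)" "replicate (p - t) 1"] by simp
  then have "val2 (rotate (m + t) (replicate m 0 @ replicate p (1::nat)))
      = (2 ^ (p - t) - 1) * 2 ^ (m + t) + (2 ^ t - 1)"
    by (simp add: val2_append)
  then have "int (val2 (rotate (m + t) (replicate m 0 @ replicate p (1::nat))))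
      = (2 ^ (p - t) - 1) * 2 ^ (m + t) + (2 ^ t - 1)"
    by (simp only: of_nat_add of_nat_mult) (simp add: of_nat_diff)
  moreover have "(2::int) ^ (p - t) * 2 ^ (m + t) = 2 ^ (m + p)"
    using assms by (simp flip: power_add)
  ultimately show ?thesis by (simp add: left_diff_distrib)
qed

section \<open>Comparison of the sorted values\<close>

theorem theorem5:
  fixes p q :: nat
  assumes "1 \<le> p" and "p < q - p"
    and "binword q w" and "count_ones w = p"
    and "\<forall>k. w \<noteq> rotate k (replicate (q - p) 0 @ replicate p 1)"
  shows "Pw (replicate (q - p) 0 @ replicate p 1) < Pw w"
proof -
  define m where "m = q - p"
  define u where "u = replicate m 0 @ replicate p (1::nat)"
  have q: "q = m + p" and m: "2 \<le> m" and pq: "p < q"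
    using assms(1,2) by (simp_all add: m_def)
  have lenw: "length w = q" and setw: "set w \<subseteq> {0, 1}"
    using assms(3) by (simp_all add: binword_def)
  have lenu: "length u = q" and setu: "set u \<subseteq> {0, 1}" and onesu: "count_ones u = p"
    by (auto simp: u_def q count_ones_def)
  \<comment> \<open>\<open>\<pi>\<close> lists the rotations of \<open>u\<close> in increasing order\<close>
  define \<pi> where "\<pi> j = (if j < m then j else m + q - 1 - j)" for j
  define U where "U j = val2 (rotate (\<pi> j) u)" for j
  define V where "V j = sort (map (\<lambda>k. val2 (rotate k w)) [0..<q]) ! j" for j
  have U_low: "U j = (2 ^ p - 1) * 2 ^ j" if "j < m" for j
    using that by (simp add: U_def \<pi>_def u_def val2_rotate_block_zeros[unfolded One_nat_def])
  have U_high: "int (U j) = 2 ^ q - 2 ^ (m + q - 1 - j) + 2 ^ (q - 1 - j) - 1"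
    if "m \<le> j" "j < q" for j
    using val2_rotate_block_ones[of "q - 1 - j" p m] that by (simp add: U_def \<pi>_def u_def q)
  \<comment> \<open>\<open>\<pi>\<close> is an involution on the indices below \<open>q\<close>,
    hence its own inverse in the reindexing.\<close>
  have U_sum: "(\<Sum>j<q. g (U j)) = (\<Sum>k<q. g (val2 (rotate k u)))" for g :: "nat \<Rightarrow> int"
    unfolding U_def by (rule sum.reindex_bij_witness[of _ \<pi> \<pi>]) (auto simp: \<pi>_def q)
  have U_prod: "(\<Prod>j<q. U j) = (\<Prod>k<q. val2 (rotate k u))"
    unfolding U_def by (rule prod.reindex_bij_witness[of _ \<pi> \<pi>]) (auto simp: \<pi>_def q)
  \<comment> \<open>The threshold is \<open>2 ^ (q - l)\<close> for \<open>l = m - j\<close>, and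
    \<open>j < m - 1\<close> gives \<open>l >= 2\<close>; at most \<open>m - l = j\<close> values
    lie below it.\<close>
  have V_low: "2 ^ (p + j) \<le> V j" if "j < m - 1" for j
    unfolding V_def
  proof (rule sort_nth_ge)
    show "card {k. k < q \<and> val2 (rotate k w) < 2 ^ (p + j)} \<le> j"
      using card_val2_less_le[OF assms(3,4,1) pq assms(5), of "m - j"] that by (simp add: q)
  qed (use that q in simp)
  have low: "U j < V j" if "j < m - 1" for j
  proof -
    have "U j < 2 ^ p * 2 ^ j"
      using that by (simp add: U_low)
    then show ?thesis using V_low[OF that] by (simp add: power_add)
  qed
  have card0: "card {k. k < q \<and> val2 (rotate k w) < 2 ^ (q - 1)} = m"
  proof -
    have "{k. k < q \<and> val2 (rotate k w) < 2 ^ (q - 1)} = {..<q} - {k. k < q \<and> w ! k = 1}"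
      using val2_rotate_less_iff[OF setw] setw lenw by (auto dest: nth_mem)
    also have "card \<dots> = q - p"
      by (subst card_Diff_subset) (use count_ones_eq_card[of w] assms(4) lenw in auto)
    finally show ?thesis by (simp add: m_def)
  qed
  \<comment> \<open>At \<open>j = m - 1\<close> the run length would be 1, outside the counting
    bound; hence the first \<open>m\<close> values are compared as a sum.\<close>
  have prefix_m: "(\<Sum>j<m. int (U j)) \<le> (\<Sum>j<m. int (V j))"
  proof -
    have "(\<Sum>j<m. int (U j)) = (2 ^ p - 1) * (\<Sum>j<m. 2 ^ j)"
      by (simp add: U_low sum_distrib_left of_nat_diff)
    also have "\<dots> = (2 ^ m - 1) * (2 ^ p - 1)"
      using power_diff_1_eq[of "2::int" m] by (simp add: mult.commute)
    also have "\<dots> \<le> int (\<Sum>k<q. if val2 (rotate k w) < 2 ^ (q - 1) then val2 (rotate k w) else 0)"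
      using sum_zero_rotations_ge[OF setw] assms(1,4) pq
      by (simp add: lenw m_def if_distrib[of int] cong: if_cong)
    also have "\<dots> = (\<Sum>j<m. int (V j))"
      unfolding V_def using sum_sort_prefix[OF card0] by (simp flip: of_nat_sum)
    finally show ?thesis .
  qed
  \<comment> \<open>Exactly \<open>m\<close> values are below \<open>2 ^ (q - 1)\<close>, so
    \<open>V m\<close> belongs to a rotation that begins with 1; \<open>U m\<close> is the value of
    \<open>1 0^m 1^(p-1)\<close>, the least possible.\<close>
  have mid: "U m \<le> V m"
  proof -
    have "m < q" using assms(1) q by simp
    have "2 ^ (q - 1) \<le> V m"
      unfolding V_def by (rule sort_nth_ge) (use card0 \<open>m < q\<close> in auto)
    moreover have "V m \<in> (\<lambda>k. val2 (rotate k w)) ` {..<q}"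
      using nth_mem[of m "sort (map (\<lambda>k. val2 (rotate k w)) [0..<q])"] \<open>m < q\<close>
      by (auto simp: V_def)
    ultimately obtain k where "V m = val2 (rotate k w)" "2 ^ (q - 1) \<le> val2 (rotate k w)"
      by auto
    then have "2 ^ (q - 1) + 2 ^ (p - 1) \<le> Suc (V m)"
      using val2_rotate_ge[OF setw, of k] assms(4) lenw \<open>m < q\<close> by (cases "w = []") auto
    then have "int (2 ^ (q - 1) + 2 ^ (p - 1)) \<le> int (Suc (V m))"
      by (simp only: of_nat_le_iff)
    then have "(2::int) ^ (q - 1) + 2 ^ (p - 1) - 1 \<le> int (V m)"
      by simp
    moreover have "int (U m) = 2 ^ (q - 1) + 2 ^ (p - 1) - 1"
      using U_high[of m] \<open>m < q\<close> by (cases q) (simp_all add: q)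
    ultimately show ?thesis by simp
  qed
  have high: "V j \<le> U j" if "m < j" "j < q" for j
  proof -
    \<comment> \<open>The rotation behind \<open>U j\<close> begins with exactly \<open>l\<close>
      ones. At most \<open>p - l = q - 1 - j\<close> rotations of \<open>w\<close> begin with
      \<open>l\<close> ones, too few to reach down to place \<open>j\<close>.\<close>
    define l where "l = Suc j - m"
    have l: "2 \<le> l" "l \<le> p" "l \<le> q" "q - l = m + q - 1 - j" "p - l < q - j"
      using that q by (auto simp: l_def)
    have "V j < 2 ^ q - 2 ^ (q - l)"
      unfolding V_def
      by (rule sort_nth_less)
        (use card_val2_ge_le[OF assms(3,4,1) pq assms(5), of l] l in linarith)
    then have "int (V j) < int (2 ^ q - 2 ^ (q - l))"
      by (simp only: of_nat_less_iff)
    also have "\<dots> = 2 ^ q - 2 ^ (q - l)"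
      by (simp add: of_nat_diff)
    also have "\<dots> \<le> int (U j)"
      using U_high[of j] that l by simp
    finally show ?thesis by simp
  qed
  have prefix: "(\<Sum>j<k. int (U j)) \<le> (\<Sum>j<k. int (V j))" if "k \<le> q" for k
  proof -
    consider "k < m" | "k = m" | "k = Suc m" | "Suc m < k" by linarith
    then show ?thesis
    proof cases
      case 1
      then show ?thesis by (intro sum_mono) (use low in \<open>simp add: less_imp_le\<close>)
    next
      case 2
      then show ?thesis using prefix_m by simp
    next
      case 3
      then show ?thesis using prefix_m mid by simp
    next
      case 4
      \<comment> \<open>The totals of \<open>U\<close> and \<open>V\<close> agree, so the bound on
        the tails from \<open>k\<close> on turns into the opposite bound on the prefixes.\<close>
      have split: "(\<Sum>j<q. f j) = (\<Sum>j<k. f j) + (\<Sum>j\<in>{k..<q}. f j)" for f :: "nat \<Rightarrow> int"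
        using sum.atLeastLessThan_concat[of 0 k q f] that by (simp add: lessThan_atLeast0)
      have "(\<Sum>j<q. int (V j)) = (\<Sum>k<q. int (val2 (rotate k w)))"
        unfolding V_def by (rule sum_nth_sort)
      also have "\<dots> = (\<Sum>k<q. int (val2 (rotate k u)))"
        using sum_val2_rotate[OF setw] sum_val2_rotate[OF setu] lenw lenu onesu assms(4) by simp
      also have "\<dots> = (\<Sum>j<q. int (U j))"
        by (rule U_sum[symmetric])
      finally have "(\<Sum>j<q. int (V j)) = (\<Sum>j<q. int (U j))" .
      moreover have "(\<Sum>j\<in>{k..<q}. int (V j)) \<le> (\<Sum>j\<in>{k..<q}. int (U j))"
        by (intro sum_mono) (use high 4 in auto)
      ultimately show ?thesis
        using split[of "\<lambda>j. int (U j)"] split[of "\<lambda>j. int (V j)"] by linarith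
    qed
  qed
  have val_pos: "0 < val2 (rotate k x)" if "count_ones x = p" for x k
    using val2_ge[of "rotate k x"] that assms(1) one_less_power[of "2::nat" p] by simp
  have "V j \<in> (\<lambda>k. val2 (rotate k w)) ` {..<q}" if "j < q" for j
    using nth_mem[of j "sort (map (\<lambda>k. val2 (rotate k w)) [0..<q])"] that by (auto simp: V_def)
  then have V_pos: "0 < V j" if "j < q" for j
    using val_pos[OF assms(4)] that by fastforce
  have "(\<Prod>j<q. real (U j)) < (\<Prod>j<q. real (V j))"
  proof (rule prod_less_of_prefix_sums_le)
    show "real (V i) \<le> real (V j)" if "i \<le> j" "j < q" for i j
      unfolding V_def using that by (simp add: sorted_nth_mono)
    show "(\<Sum>j<k. real (U j)) \<le> (\<Sum>j<k. real (V j))" if "k \<le> q" for k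
      using prefix[OF that] by (simp only: of_nat_sum[symmetric] of_nat_le_iff)
    \<comment> \<open>\<open>m >= 2\<close> puts index 0 below \<open>m - 1\<close>, where the
      comparison is strict.\<close>
    show "real (U 0) \<noteq> real (V 0)"
      using low[of 0] m by simp
  qed (use V_pos val_pos[OF onesu] m q in \<open>auto simp: U_def\<close>)
  then have "(\<Prod>j<q. U j) < (\<Prod>j<q. V j)"
    by (simp only: of_nat_prod[symmetric] of_nat_less_iff)
  also have "(\<Prod>j<q. V j) = Pw w"
    unfolding V_def Pw_eq lenw by (rule prod_nth_sort)
  also have "(\<Prod>j<q. U j) = Pw u"
    by (simp only: U_prod Pw_eq lenu)
  finally show ?thesis
    by (simp only: u_def m_def)
qed

end
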